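(* Let $n\ge1$, $r\ge1$ be integers and let $\lambda(x)=\exp\left(\frac{2\pi\sqrt{-1}\,ax}{n}\right)$ be an additive character of $\mathbb{Z}_n$ with $a\in\mathbb{Z}$, $\gcd(a,n)=1$ (i.e. $\lambda$ has order $n$). Then $$G(\mathrm{SL}_r(\mathbb{Z}_n),\lambda)=n^{\frac{r(r-1)}{2}}K_r(\mathbb{Z}_n,\lambda).$$
   Context: $\mathbb{Z}_n=\mathbb{Z}/n\mathbb{Z}$; $\mathrm{SL}_r(\mathbb{Z}_n)$ is the group of $r\times r$ matrices over $\mathbb{Z}_n$ with determinant $1$. $G(\mathrm{SL}_r(\mathbb{Z}_n),\lambda)=\sum_{X\in\mathrm{SL}_r(\mathbb{Z}_n)}\lambda(\mathrm{tr}\,X)$, and the hyper-Kloosterman sum is $K_r(\mathbb{Z}_n,\lambda)=\sum_{x_1,\dots,x_r\in\mathbb{Z}_n,\ x_1x_2\cdots x_r=1}\lambda(x_1+x_2+\cdots+x_r)$. *)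

theory Defs
  imports Complex_Main "HOL-Library.FuncSet" "HOL-Number_Theory.Cong"
    "Jordan_Normal_Form.Determinant"
begin

text \<open>
  The ring of integers modulo \<open>n\<close> is represented by the least nonnegative residues; equations
  in it are congruences of integers. This covers every \<open>n \<ge> 1\<close>, including the zero ring
  for \<open>n = 1\<close>, which has no counterpart as a type of class \<open>comm_ring_1\<close>.
\<close>

definition Zn :: "nat \<Rightarrow> int set" where
  "Zn n = {0..<int n}"

definition SL :: "nat \<Rightarrow> nat \<Rightarrow> int mat set" where
  "SL r n = {X \<in> carrier_mat r r. elements_mat X \<subseteq> Zn n \<and> [det X = 1] (mod int n)}"

definition mat_tr :: "int mat \<Rightarrow> int" where
  "mat_tr X = (\<Sum>i<dim_row X. X $$ (i, i))"

text \<open>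
  A function on the integers modulo \<open>n\<close> is represented by an \<open>n\<close>-periodic function on the
  integers; see \<open>add_char_cong\<close> below. Hence the arguments \<open>mat_tr X\<close> and \<open>\<Sum>i<r. x i\<close> in
  the two exponential sums need not be reduced.
\<close>

definition add_char :: "nat \<Rightarrow> int \<Rightarrow> int \<Rightarrow> complex" where
  "add_char n a x = exp (2 * of_real pi * \<i> * of_int a * of_int x / of_nat n)"

definition gauss_sum_SL :: "nat \<Rightarrow> nat \<Rightarrow> (int \<Rightarrow> complex) \<Rightarrow> complex" where
  "gauss_sum_SL r n \<psi> = (\<Sum>X\<in>SL r n. \<psi> (mat_tr X))"

definition kloosterman_tuples :: "nat \<Rightarrow> nat \<Rightarrow> (nat \<Rightarrow> int) set" where
  "kloosterman_tuples r n = {x \<in> {..<r} \<rightarrow>\<^sub>E Zn n. [(\<Prod>i<r. x i) = 1] (mod int n)}"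

definition hyper_kloosterman :: "nat \<Rightarrow> nat \<Rightarrow> (int \<Rightarrow> complex) \<Rightarrow> complex" where
  "hyper_kloosterman r n \<psi> = (\<Sum>x\<in>kloosterman_tuples r n. \<psi> (\<Sum>i<r. x i))"

lemma add_char_cong:
  assumes "n \<ge> 1" and "[x = y] (mod int n)"
  shows "add_char n a x = add_char n a y"
proof -
  from assms(2) obtain k where k: "y = x + int n * k"
    using cong_iff_lin by blast
  have "2 * of_real pi * \<i> * of_int a * of_int y / of_nat n =
      2 * of_real pi * \<i> * of_int a * of_int x / of_nat n
        + (2 * of_int (a * k) * of_real pi) * \<i>"
    using assms(1) by (simp add: k field_simps)
  moreover have "exp ((2 * of_int (a * k) * of_real pi) * \<i>) = (1 :: complex)"
    using cis_multiple_2pi[of "of_int (a * k)"] by (simp add: cis_conv_exp mult_ac)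
  ultimately show ?thesis
    by (simp add: add_char_def exp_add)
qed

lemma det_cong:
  fixes A B :: "int mat"
  assumes "A \<in> carrier_mat r r" and "B \<in> carrier_mat r r"
    and "\<And>i j. i < r \<Longrightarrow> j < r \<Longrightarrow> [A $$ (i, j) = B $$ (i, j)] (mod m)"
  shows "[det A = det B] (mod m)"
  unfolding det_def'[OF assms(1)] det_def'[OF assms(2)]
  by (intro cong_sum cong_mult cong_prod cong_refl assms(3))
    (auto dest: permutes_in_image)

lemma finite_SL: "finite (SL r n)"
proof (rule finite_subset)
  let ?P = "({..<r} \<times> {..<r}) \<rightarrow>\<^sub>E Zn n"
  show "SL r n \<subseteq> (\<lambda>f. mat r r f) ` ?P"
  proof
    fix X assume X: "X \<in> SL r n"
    have dims: "dim_row X = r" "dim_col X = r"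
      using X by (auto simp: SL_def)
    have ent: "X $$ (i, j) \<in> Zn n" if "i < r" "j < r" for i j
      using X that by (auto simp: SL_def)
    have "X = mat r r (restrict (\<lambda>p. X $$ p) ({..<r} \<times> {..<r}))"
      by (rule eq_matI) (auto simp: dims)
    moreover have "restrict (\<lambda>p. X $$ p) ({..<r} \<times> {..<r}) \<in> ?P"
      using ent by auto
    ultimately show "X \<in> (\<lambda>f. mat r r f) ` ?P" by blast
  qed
  show "finite ((\<lambda>f. mat r r f) ` ?P)"
    by (intro finite_imageI finite_PiE) (auto simp: Zn_def)
qed

lemma finite_kloosterman_tuples: "finite (kloosterman_tuples r n)"
proof -
  have "finite ({..<r} \<rightarrow>\<^sub>E Zn n)"
    by (intro finite_PiE) (auto simp: Zn_def)
  thus ?thesis by (simp add: kloosterman_tuples_def)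
qed

end

theory Submission
  imports Defs
begin

text \<open>
  Right multiplication by a fixed lower unitriangular matrix \<open>U\<close> permutes the special linear
  group, so the Gauss sum may be averaged over all such \<open>U\<close>. Since \<open>tr (X U)\<close> is \<open>tr X\<close> plus a
  linear form in the free entries of \<open>U\<close> whose coefficients are the entries of \<open>X\<close> above the
  diagonal, orthogonality of characters leaves only the lower triangular \<open>X\<close>. Their diagonals are
  the tuples of the Kloosterman sum, and each of the \<open>r (r - 1) / 2\<close> entries below the diagonal
  contributes a factor \<open>n\<close>.
\<close>

section \<open>Characters\<close>

lemma add_char_add: "add_char n a (x + y) = add_char n a x * add_char n a y"
  by (simp add: add_char_def exp_add[symmetric] ring_distribs add_divide_distrib)

lemma add_char_0 [simp]: "add_char n a 0 = 1"
  by (simp add: add_char_def)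

lemma add_char_sum: "add_char n a (sum f A) = (\<Prod>x\<in>A. add_char n a (f x))"
  by (induction A rule: infinite_finite_induct) (simp_all add: add_char_add)

lemma add_char_mult_nat: "add_char n a (x * int k) = add_char n a x ^ k"
  by (induction k) (simp_all add: add_char_add ring_distribs)

text \<open>The value 1 forces \<open>a * x / n\<close> to be an integer, and coprimality of
  \<open>a\<close> and \<open>n\<close> then cancels \<open>a\<close>. This is where the order of
  the character being exactly \<open>n\<close> enters.\<close>

lemma add_char_eq_1_imp_dvd:
  assumes "n \<ge> 1" and "gcd a (int n) = 1" and "add_char n a x = 1"
  shows "int n dvd x"
proof -
  have "cis (2 * pi * (of_int a * of_int x / of_nat n)) = 1"
    using assms(3) by (simp add: add_char_def cis_conv_exp mult_ac)
  then have "cos (2 * pi * (of_int a * of_int x / of_nat n)) = 1"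
    by (simp add: complex_eq_iff)
  then obtain k :: int where "2 * pi * (of_int a * of_int x / of_nat n) = k * 2 * pi"
    by (auto simp: cos_one_2pi_int)
  then have "real_of_int (a * x) = real_of_int (k * int n)"
    using assms(1) by (simp add: field_simps)
  then have "a * x = k * int n"
    by (simp only: of_int_eq_iff)
  then have "int n dvd a * x"
    by simp
  moreover have "coprime (int n) a"
    using assms(2) by (simp add: coprime_iff_gcd_eq_1 gcd.commute)
  ultimately show ?thesis
    by (simp add: coprime_dvd_mult_right_iff)
qed

text \<open>Orthogonality: the sum is geometric in \<open>add_char n a c\<close>, an
  \<open>n\<close>-th root of unity that differs from 1 as soon as \<open>n\<close> does not divide
  \<open>c\<close>.\<close>

lemma sum_add_char_mult:
  assumes "n \<ge> 1" and "gcd a (int n) = 1" and "c \<in> Zn n"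
  shows "(\<Sum>t\<in>Zn n. add_char n a (c * t)) = (if c = 0 then of_nat n else 0)"
proof (cases "c = 0")
  case True
  then show ?thesis by (simp add: Zn_def)
next
  case False
  let ?w = "add_char n a c"
  have "Zn n = int ` {..<n}"
    by (auto simp: Zn_def lessThan_atLeast0 image_int_atLeastLessThan)
  then have sum_eq: "(\<Sum>t\<in>Zn n. add_char n a (c * t)) = (\<Sum>k<n. ?w ^ k)"
    by (simp add: sum.reindex add_char_mult_nat)
  \<comment> \<open>The only multiple of \<open>n\<close> among the least residues is 0.\<close>
  have "\<not> int n dvd c"
    using False assms(3) zdvd_not_zless[of c "int n"] by (auto simp: Zn_def)
  then have "?w \<noteq> 1"
    using add_char_eq_1_imp_dvd[OF assms(1,2), of c] by auto
  moreover have "?w ^ n = 1"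
    using add_char_cong[OF assms(1), of "c * int n" 0 a]
    by (simp add: add_char_mult_nat cong_0_iff)
  ultimately show ?thesis
    using False sum_eq one_diff_power_eq[of ?w n] by simp
qed

section \<open>Lower triangular matrices\<close>

definition below_diag :: "nat \<Rightarrow> (nat \<times> nat) set" where
  "below_diag r = Sigma {..<r} (\<lambda>i. {..<i})"

text \<open>One family serves two purposes: with \<open>x\<close> constantly 1 it gives the matrices
  over which the Gauss sum is averaged, with general \<open>x\<close> the matrices that survive the
  averaging.\<close>

definition lower_tri :: "nat \<Rightarrow> (nat \<Rightarrow> int) \<Rightarrow> (nat \<times> nat \<Rightarrow> int) \<Rightarrow> int mat" where
  "lower_tri r x u = mat r r (\<lambda>(i, j). if i = j then x i else if j < i then u (i, j) else 0)"

lemma finite_below_diag [simp]: "finite (below_diag r)"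
  by (simp add: below_diag_def)

lemma card_below_diag: "card (below_diag r) = r * (r - 1) div 2"
proof -
  have "card (below_diag r) = (\<Sum>i<r. i)"
    by (simp add: below_diag_def)
  also have "\<dots> = r * (r - 1) div 2"
    by (simp add: lessThan_atLeast0 Sum_Ico_nat)
  finally show ?thesis .
qed

lemma card_below_diag_fun: "card (below_diag r \<rightarrow>\<^sub>E Zn n) = n ^ (r * (r - 1) div 2)"
  by (simp add: card_PiE card_below_diag Zn_def)

lemma lower_tri_carrier [simp]: "lower_tri r x u \<in> carrier_mat r r"
  by (simp add: lower_tri_def)

lemma dim_lower_tri [simp]: "dim_row (lower_tri r x u) = r" "dim_col (lower_tri r x u) = r"
  by (simp_all add: lower_tri_def)

lemma lower_tri_index [simp]:
  "i < r \<Longrightarrow> j < r \<Longrightarrow>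
    lower_tri r x u $$ (i, j) = (if i = j then x i else if j < i then u (i, j) else 0)"
  by (simp add: lower_tri_def)

lemma det_lower_tri: "det (lower_tri r x u) = (\<Prod>i<r. x i)"
proof -
  have "det (lower_tri r x u) = prod_list (diag_mat (lower_tri r x u))"
    by (rule det_lower_triangular[where n = r]) auto
  also have "\<dots> = (\<Prod>i<r. x i)"
    by (simp add: prod_list_diag_prod lessThan_atLeast0)
  finally show ?thesis .
qed

lemma mat_tr_lower_tri: "mat_tr (lower_tri r x u) = (\<Sum>i<r. x i)"
  by (simp add: mat_tr_def)

text \<open>The trace of a product pairs each entry of one factor with the transposed entry of the
  other, hence \<open>prod.swap\<close>. The unit diagonal contributes the trace of
  \<open>X\<close>.\<close>

lemma mat_tr_mult_unitriangular:
  assumes "X \<in> carrier_mat r r"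
  shows "mat_tr (X * lower_tri r (\<lambda>_. 1) u) =
    mat_tr X + (\<Sum>p\<in>below_diag r. X $$ prod.swap p * u p)"
proof -
  let ?U = "lower_tri r (\<lambda>_. 1) u"
  have inner: "(\<Sum>j<r. X $$ (j, i) * ?U $$ (i, j)) =
      X $$ (i, i) + (\<Sum>j<i. X $$ (j, i) * u (i, j))" if "i < r" for i
  proof -
    have "(\<Sum>j<r. X $$ (j, i) * ?U $$ (i, j)) = (\<Sum>j\<le>i. X $$ (j, i) * ?U $$ (i, j))"
      using that by (intro sum.mono_neutral_right) auto
    also have "\<dots> = (\<Sum>j<i. X $$ (j, i) * ?U $$ (i, j)) + X $$ (i, i)"
      using that by (simp flip: lessThan_Suc_atMost)
    also have "(\<Sum>j<i. X $$ (j, i) * ?U $$ (i, j)) = (\<Sum>j<i. X $$ (j, i) * u (i, j))"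
      using that by (intro sum.cong) auto
    finally show ?thesis by simp
  qed
  have "mat_tr (X * ?U) = (\<Sum>j<r. \<Sum>i<r. X $$ (j, i) * ?U $$ (i, j))"
    using assms
    by (auto simp: mat_tr_def scalar_prod_def lessThan_atLeast0 intro!: sum.cong)
  also have "\<dots> = (\<Sum>i<r. \<Sum>j<r. X $$ (j, i) * ?U $$ (i, j))"
    by (rule sum.swap)
  also have "\<dots> = (\<Sum>i<r. X $$ (i, i) + (\<Sum>j<i. X $$ (j, i) * u (i, j)))"
    by (intro sum.cong inner) auto
  also have "\<dots> = mat_tr X + (\<Sum>p\<in>below_diag r. X $$ prod.swap p * u p)"
    using assms by (simp add: sum.distrib mat_tr_def below_diag_def sum.Sigma split_beta
        prod.swap_def)
  finally show ?thesis .
qed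

section \<open>The special linear group modulo \<open>n\<close>\<close>

lemma SL_iff:
  "X \<in> SL r n \<longleftrightarrow> X \<in> carrier_mat r r \<and> (\<forall>i<r. \<forall>j<r. X $$ (i, j) \<in> Zn n) \<and>
    [det X = 1] (mod int n)"
  by (fastforce simp: SL_def)

text \<open>Matrix products are formed over the integers; this brings them back to the chosen
  representatives.\<close>

definition reduce_mat :: "nat \<Rightarrow> int mat \<Rightarrow> int mat" where
  "reduce_mat n X = map_mat (\<lambda>x. x mod int n) X"

lemma reduce_mat_carrier [simp]: "reduce_mat n X \<in> carrier_mat r c \<longleftrightarrow> X \<in> carrier_mat r c"
  by (simp add: reduce_mat_def)

lemma reduce_mat_cong:
  "X \<in> carrier_mat r c \<Longrightarrow> i < r \<Longrightarrow> j < c \<Longrightarrow> [reduce_mat n X $$ (i, j) = X $$ (i, j)] (mod int n)"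
  by (auto simp: reduce_mat_def)

lemma reduce_mat_in_SL:
  assumes "n \<ge> 1" and "X \<in> carrier_mat r r" and "[det X = 1] (mod int n)"
  shows "reduce_mat n X \<in> SL r n"
proof -
  have "[det (reduce_mat n X) = det X] (mod int n)"
    using assms(2) by (intro det_cong[of _ r] reduce_mat_cong) auto
  then have "[det (reduce_mat n X) = 1] (mod int n)"
    using assms(3) cong_trans by blast
  then show ?thesis
    using assms(1,2) by (auto simp: SL_iff) (auto simp: reduce_mat_def Zn_def)
qed

lemma mat_tr_reduce_cong:
  "X \<in> carrier_mat r r \<Longrightarrow> [mat_tr (reduce_mat n X) = mat_tr X] (mod int n)"
  unfolding mat_tr_def by (auto simp: reduce_mat_def intro!: cong_sum)

lemma mult_mat_right_cong:
  fixes A B V :: "int mat"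
  assumes "A \<in> carrier_mat r r" "B \<in> carrier_mat r r" "V \<in> carrier_mat r r"
    and "\<And>i j. i < r \<Longrightarrow> j < r \<Longrightarrow> [A $$ (i, j) = B $$ (i, j)] (mod m)"
    and "i < r" "j < r"
  shows "[(A * V) $$ (i, j) = (B * V) $$ (i, j)] (mod m)"
  using assms by (auto simp: scalar_prod_def intro!: cong_sum cong_mult)

text \<open>Multiplying by the adjugate of \<open>U\<close> undoes the map modulo \<open>n\<close>,
  so it is injective, and an injective self-map of a finite set is bijective.\<close>

lemma bij_betw_SL_mult_det_1:
  assumes "n \<ge> 1" and U: "U \<in> carrier_mat r r" and "det U = 1"
  shows "bij_betw (\<lambda>X. reduce_mat n (X * U)) (SL r n) (SL r n)"
proof -
  let ?f = "\<lambda>X. reduce_mat n (X * U)"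
  have maps: "?f ` SL r n \<subseteq> SL r n"
  proof (rule image_subsetI)
    fix X assume "X \<in> SL r n"
    then show "?f X \<in> SL r n"
      using assms by (intro reduce_mat_in_SL) (auto simp: SL_iff det_mult[of _ r])
  qed
  have "inj_on ?f (SL r n)"
  proof (rule inj_onI)
    fix X Y assume X: "X \<in> SL r n" and Y: "Y \<in> SL r n" and eq: "?f X = ?f Y"
    have cX: "X \<in> carrier_mat r r" and cY: "Y \<in> carrier_mat r r"
      using X Y by (auto simp: SL_iff)
    note V = adj_mat[OF U]
    \<comment> \<open>As \<open>det U\<close> is 1 in the integers and not just modulo
      \<open>n\<close>, the adjugate is an exact integer inverse.\<close>
    have "U * adj_mat U = 1\<^sub>m r"
      unfolding V(2) assms(3) by (rule eq_matI) auto
    then have cancel: "Z * U * adj_mat U = Z" if "Z \<in> carrier_mat r r" for Z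
      using that U V(1) by (simp add: assoc_mult_mat[of _ r r _ r _ r])
    have XU: "[(X * U) $$ (i, j) = (Y * U) $$ (i, j)] (mod int n)" if "i < r" "j < r" for i j
    proof -
      have "[(X * U) $$ (i, j) = ?f X $$ (i, j)] (mod int n)"
        using that cX U by (intro cong_sym[OF reduce_mat_cong[of _ r r]] mult_carrier_mat)
      moreover have "[?f X $$ (i, j) = (Y * U) $$ (i, j)] (mod int n)"
        unfolding eq using that cY U by (intro reduce_mat_cong[of _ r r] mult_carrier_mat)
      ultimately show ?thesis by (rule cong_trans)
    qed
    have XY: "[X $$ (i, j) = Y $$ (i, j)] (mod int n)" if "i < r" "j < r" for i j
      using mult_mat_right_cong[of "X * U" r "Y * U" "adj_mat U", OF _ _ V(1) XU that]
        cX cY U cancel by simp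
    \<comment> \<open>Congruent entries are equal, since both lie in
      \<open>{0..<int n}\<close>.\<close>
    have "X $$ (i, j) = Y $$ (i, j)" if "i < r" "j < r" for i j
      using XY[OF that] X Y that
      by (intro cong_less_imp_eq_int[of _ "int n"]) (auto simp: SL_iff Zn_def)
    then show "X = Y"
      using cX cY by (intro eq_matI) auto
  qed
  then show ?thesis
    using maps endo_inj_surj[OF finite_SL maps] by (simp add: bij_betw_def)
qed

section \<open>Evaluation of the Gauss sum\<close>

text \<open>Reindex the sum by \<open>X\<close> going to \<open>X * U\<close>; periodicity of the
  character removes the reduction modulo \<open>n\<close>. The left side does not involve
  \<open>u\<close>, which makes averaging over \<open>u\<close> possible.\<close>

lemma gauss_sum_SL_unitriangular_translate:
  assumes "n \<ge> 1"
  shows "gauss_sum_SL r n (add_char n a) =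
    (\<Sum>X\<in>SL r n. add_char n a (mat_tr X) *
      (\<Prod>p\<in>below_diag r. add_char n a (X $$ prod.swap p * u p)))"
proof -
  let ?U = "lower_tri r (\<lambda>_. 1) u"
  have "gauss_sum_SL r n (add_char n a) =
      (\<Sum>X\<in>SL r n. add_char n a (mat_tr (reduce_mat n (X * ?U))))"
    unfolding gauss_sum_SL_def
    by (intro sum.reindex_bij_betw[symmetric] bij_betw_SL_mult_det_1 assms)
      (simp_all add: det_lower_tri)
  also have "\<dots> = (\<Sum>X\<in>SL r n. add_char n a (mat_tr (X * ?U)))"
    by (intro sum.cong add_char_cong[OF assms] mat_tr_reduce_cong[of _ r] refl)
      (auto simp: SL_iff)
  also have "\<dots> = (\<Sum>X\<in>SL r n. add_char n a (mat_tr X) *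
      (\<Prod>p\<in>below_diag r. add_char n a (X $$ prod.swap p * u p)))"
    by (intro sum.cong refl)
      (simp add: SL_iff mat_tr_mult_unitriangular add_char_add add_char_sum)
  finally show ?thesis .
qed

text \<open>The sum over all functions \<open>u\<close> factors into independent sums over single
  residues, each equal to \<open>n\<close> or 0 by orthogonality.\<close>

lemma sum_prod_add_char:
  assumes "n \<ge> 1" and "gcd a (int n) = 1" and "finite P" and "\<And>p. p \<in> P \<Longrightarrow> c p \<in> Zn n"
  shows "(\<Sum>u\<in>P \<rightarrow>\<^sub>E Zn n. \<Prod>p\<in>P. add_char n a (c p * u p)) =
    (if \<forall>p\<in>P. c p = 0 then of_nat n ^ card P else 0)"
proof -
  have "(\<Sum>u\<in>P \<rightarrow>\<^sub>E Zn n. \<Prod>p\<in>P. add_char n a (c p * u p)) =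
      (\<Prod>p\<in>P. \<Sum>t\<in>Zn n. add_char n a (c p * t))"
    using assms(3) by (intro prod_sum_PiE[symmetric]) (auto simp: Zn_def)
  also have "\<dots> = (\<Prod>p\<in>P. if c p = 0 then of_nat n else 0)"
    using assms by (intro prod.cong sum_add_char_mult) auto
  also have "\<dots> = (if \<forall>p\<in>P. c p = 0 then of_nat n ^ card P else 0)"
    using assms(3) by (auto intro!: prod_zero)
  finally show ?thesis .
qed

text \<open>A lower triangular matrix is its diagonal together with its entries below. Determinant
  and trace see only the diagonal, so the entries below are free and merely multiply the sum by
  their number of choices.\<close>

lemma sum_SL_lower_triangular:
  "(\<Sum>X | X \<in> SL r n \<and> (\<forall>p\<in>below_diag r. X $$ prod.swap p = 0). \<psi> (mat_tr X)) =
    of_nat n ^ (r * (r - 1) div 2) * hyper_kloosterman r n \<psi>"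
proof -
  let ?L = "{X \<in> SL r n. \<forall>p\<in>below_diag r. X $$ prod.swap p = 0}"
  let ?K = "kloosterman_tuples r n" and ?F = "below_diag r \<rightarrow>\<^sub>E Zn n"
  have "(\<Sum>X\<in>?L. \<psi> (mat_tr X)) = (\<Sum>(x, u)\<in>?K \<times> ?F. \<psi> (\<Sum>i<r. x i))"
  \<comment> \<open>\<open>restrict\<close> makes both components extensional, as membership in the
    function spaces \<open>?K\<close> and \<open>?F\<close> demands.\<close>
  proof (rule sum.reindex_bij_witness[where i = "\<lambda>(x, u). lower_tri r x u" and
        j = "\<lambda>X. (restrict (\<lambda>i. X $$ (i, i)) {..<r}, restrict (\<lambda>p. X $$ p) (below_diag r))"])
    fix X assume X: "X \<in> ?L"
    let ?x = "restrict (\<lambda>i. X $$ (i, i)) {..<r}" and ?u = "restrict (\<lambda>p. X $$ p) (below_diag r)"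
    have zero: "X $$ (i, j) = 0" if "i < j" "j < r" for i j
      using X that by (force simp: below_diag_def)
    have X_eq: "lower_tri r ?x ?u = X"
      using X zero by (intro eq_matI) (auto simp: SL_iff below_diag_def lower_tri_def)
    then show "(case (?x, ?u) of (x, u) \<Rightarrow> lower_tri r x u) = X"
      by simp
    have "(\<Prod>i<r. ?x i) = det X"
      using det_lower_tri[of r ?x ?u] X_eq by simp
    then show "(?x, ?u) \<in> ?K \<times> ?F"
      using X by (auto simp: kloosterman_tuples_def SL_iff below_diag_def)
    have "(\<Sum>i<r. ?x i) = mat_tr X"
      using mat_tr_lower_tri[of r ?x ?u] X_eq by simp
    then show "(case (?x, ?u) of (x, u) \<Rightarrow> \<psi> (\<Sum>i<r. x i)) = \<psi> (mat_tr X)"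
      by simp
  next
    fix xu assume "xu \<in> ?K \<times> ?F"
    then obtain x u where xu: "xu = (x, u)" and x: "x \<in> ?K" and u: "u \<in> ?F"
      by auto
    have "restrict (\<lambda>i. lower_tri r x u $$ (i, i)) {..<r} = x"
      using x by (auto simp: kloosterman_tuples_def fun_eq_iff PiE_def extensional_def)
    moreover have "restrict (\<lambda>p. lower_tri r x u $$ p) (below_diag r) = u"
      using u by (auto simp: fun_eq_iff PiE_def extensional_def below_diag_def)
    ultimately show "(restrict (\<lambda>i. (case xu of (x, u) \<Rightarrow> lower_tri r x u) $$ (i, i)) {..<r},
        restrict (\<lambda>p. (case xu of (x, u) \<Rightarrow> lower_tri r x u) $$ p) (below_diag r)) = xu"
      by (simp add: xu)
    have "x i \<in> Zn n" if "i < r" for i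
      using x that by (auto simp: kloosterman_tuples_def)
    moreover have "u (i, j) \<in> Zn n" if "j < i" "i < r" for i j
      using u that by (auto simp: below_diag_def)
    \<comment> \<open>The zeros above the diagonal must be residues too, which requires
      \<open>n\<close> to be positive; any diagonal entry witnesses this.\<close>
    moreover have "0 \<in> Zn n" if "x i \<in> Zn n" for i
      using that by (auto simp: Zn_def)
    ultimately have "lower_tri r x u \<in> SL r n"
      using x by (auto simp: SL_iff det_lower_tri kloosterman_tuples_def)
    then show "(case xu of (x, u) \<Rightarrow> lower_tri r x u) \<in> ?L"
      by (auto simp: xu below_diag_def)
  qed
  also have "\<dots> = (\<Sum>x\<in>?K. \<Sum>u\<in>?F. \<psi> (\<Sum>i<r. x i))"
    by (rule sum.cartesian_product[symmetric])
  also have "\<dots> = of_nat n ^ (r * (r - 1) div 2) * hyper_kloosterman r n \<psi>"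
    by (simp add: card_below_diag_fun hyper_kloosterman_def sum_distrib_left)
  finally show ?thesis .
qed

theorem theorem4:
  fixes n r :: nat and a :: int
  assumes "n \<ge> 1" and "r \<ge> 1" and "gcd a (int n) = 1"
  shows "gauss_sum_SL r n (add_char n a) =
    of_nat n ^ (r * (r - 1) div 2) * hyper_kloosterman r n (add_char n a)"
proof -
  let ?\<psi> = "add_char n a" and ?F = "below_diag r \<rightarrow>\<^sub>E Zn n"
  let ?N = "of_nat n ^ (r * (r - 1) div 2) :: complex"
  let ?lower = "\<lambda>X. \<forall>p\<in>below_diag r. X $$ prod.swap p = (0 :: int)"
  \<comment> \<open>\<open>?N\<close> is the number of choices of \<open>u\<close>, so this sums a
    constant.\<close>
  have "?N * gauss_sum_SL r n ?\<psi> = (\<Sum>u\<in>?F. gauss_sum_SL r n ?\<psi>)"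
    by (simp add: card_below_diag_fun)
  also have "\<dots> = (\<Sum>u\<in>?F. \<Sum>X\<in>SL r n. ?\<psi> (mat_tr X) *
      (\<Prod>p\<in>below_diag r. ?\<psi> (X $$ prod.swap p * u p)))"
    by (intro sum.cong gauss_sum_SL_unitriangular_translate assms(1) refl)
  also have "\<dots> = (\<Sum>X\<in>SL r n. ?\<psi> (mat_tr X) *
      (\<Sum>u\<in>?F. \<Prod>p\<in>below_diag r. ?\<psi> (X $$ prod.swap p * u p)))"
    by (subst sum.swap) (simp add: sum_distrib_left)
  \<comment> \<open>For fixed \<open>X\<close>, orthogonality in \<open>u\<close> tests whether all
    entries above the diagonal vanish.\<close>
  also have "\<dots> = (\<Sum>X\<in>SL r n. ?\<psi> (mat_tr X) * (if ?lower X then ?N else 0))"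
    unfolding card_below_diag[symmetric]
    by (intro sum.cong arg_cong2[where f = "(*)"] sum_prod_add_char assms refl)
      (auto simp: SL_iff below_diag_def)
  also have "\<dots> = ?N * (\<Sum>X | X \<in> SL r n \<and> ?lower X. ?\<psi> (mat_tr X))"
    by (simp add: sum.inter_filter finite_SL sum_distrib_left if_distrib mult.commute cong: if_cong)
  finally have "?N * gauss_sum_SL r n ?\<psi> =
      ?N * (\<Sum>X | X \<in> SL r n \<and> ?lower X. ?\<psi> (mat_tr X))" .
  \<comment> \<open>The factor \<open>?N\<close> cancels because \<open>n\<close> is nonzero; the
    power of \<open>n\<close> in the result comes from the lower triangular matrices.\<close>
  then show ?thesis
    using assms(1) by (simp add: sum_SL_lower_triangular)
qed

end
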